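(* Let $T:X\to X$ be a non-singular measurable transformation and $u:X\to\mathbb C$ a measurable function, not a.e. zero, such that $W_{u,T}$ is a bounded operator on $L(p,q)$ and $\mu(T(A))\le\mu(A)$ for each $A\in\mathcal A$. Suppose also that $h_T=0$ a.e. on $(\mathrm{Supp}(u))^c$ and $u\in L_\infty(\mu)$. If $k$ is the smallest non-negative integer such that $X_k^c\subseteq T^{k+1}(X_k^c)$ (containment up to a $\mu$-null set), where $X_k^c=X\setminus X_k$, then $\alpha(W_{u,T})=k$.
   Context: $(X,\mathcal A,\mu)$ is a $\sigma$-finite complete measure space. For measurable $h:X\to\mathbb C$ put $\mu_h(s)=\mu(\{x\in X:|h(x)|>s\})$ for $s\ge 0$, $h^*(t)=\inf\{s>0:\mu_h(s)\le t\}$ and $h^{**}(t)=\frac1t\int_0^t h^*(s)\,ds$ for $t>0$. The Lorentz space $L(p,q)$ (for $1<p<\infty$, $1\le q<\infty$, or $1<p\le\infty$, $q=\infty$) is the Banach space of (a.e.-equivalence classes of) measurable $h:X\to\mathbb C$ with $\|h\|_{pq}<\infty$, where $\|h\|_{pq}=\left(\frac qp\int_0^\infty (t^{1/p}h^{**}(t))^q\frac{dt}{t}\right)^{1/q}$ if $1<p<\infty$, $1\le q<\infty$, and $\|h\|_{pq}=\sup_{t>0}t^{1/p}h^{**}(t)$ if $1<p\le\infty$, $q=\infty$. A measurable transformation $T:X\to X$ is non-singular if $\mu(A)=0$ implies $\mu(T^{-1}(A))=0$. For $k\ge 0$, $\mu_k(A)=\mu(T^{-k}(A))$ (so $\mu_0=\mu$),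 and $h_{T^k}\ge 0$ is the (locally integrable) Radon–Nikodym derivative: $\mu_k(A)=\int_A h_{T^k}\,d\mu$ for $A\in\mathcal A$. $X_k=\{x\in X:h_{T^k}(x)=0\}$. The containment $X_k^c\subseteq T^{k+1}(X_k^c)$ means $\mu(X_k^c\setminus T^{k+1}(X_k^c))=0$. The hypothesis $\mu(T(A))\le\mu(A)$ for $A\in\mathcal A$ includes that $T(A)\in\mathcal A$. $\mathrm{Supp}(u)=\{x:u(x)\ne 0\}$ and $(\mathrm{Supp}(u))^c$ is its complement. $W_{u,T}f=(u\circ T)\cdot(f\circ T)$. For a bounded operator $L$ with null space $\mathcal N(L)$, the ascent is $\alpha(L)=\inf\{k\in\mathbb N\cup\{0\}:\mathcal N(L^{k+1})=\mathcal N(L^k)\}$ (equal to $\infty$ if no such $k$ exists). *)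

theory Defs
  imports "HOL-Analysis.Analysis"
begin

section \<open>Lorentz norms\<close>

definition distribution_fun :: "'a measure \<Rightarrow> ('a \<Rightarrow> complex) \<Rightarrow> real \<Rightarrow> ennreal" where
  "distribution_fun M h s = emeasure M {x \<in> space M. norm (h x) > s}"

text \<open>Values lie in \<^typ>\<open>ennreal\<close>, so the infimum of the empty set is \<open>\<infinity>\<close>.\<close>

definition decr_rearr :: "'a measure \<Rightarrow> ('a \<Rightarrow> complex) \<Rightarrow> real \<Rightarrow> ennreal" where
  "decr_rearr M h t = Inf (ennreal ` {s. s > 0 \<and> distribution_fun M h s \<le> ennreal t})"

definition max_rearr :: "'a measure \<Rightarrow> ('a \<Rightarrow> complex) \<Rightarrow> real \<Rightarrow> ennreal" where
  "max_rearr M h t = ennreal (1 / t) * (\<integral>\<^sup>+ s\<in>{0<..<t}. decr_rearr M h s \<partial>lborel)"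

text \<open>Real powers of extended nonnegative reals; only used with exponent \<open>a > 0\<close>.\<close>

definition enn_rpow :: "ennreal \<Rightarrow> real \<Rightarrow> ennreal" where
  "enn_rpow x a = (if x = \<infinity> then \<infinity> else ennreal (enn2real x powr a))"

definition lorentz_exponents :: "ennreal \<Rightarrow> ennreal \<Rightarrow> bool" where
  "lorentz_exponents p q \<longleftrightarrow>
     (1 < p \<and> p < \<infinity> \<and> 1 \<le> q \<and> q < \<infinity>) \<or> (1 < p \<and> p \<le> \<infinity> \<and> q = \<infinity>)"

text \<open>For \<open>p = \<infinity>\<close> the exponent \<open>1/p\<close> is \<^term>\<open>enn2real (1 / \<infinity>) = 0\<close>.\<close>

definition lorentz_norm :: "'a measure \<Rightarrow> ennreal \<Rightarrow> ennreal \<Rightarrow> ('a \<Rightarrow> complex) \<Rightarrow> ennreal" where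
  "lorentz_norm M p q h =
     (if q = \<infinity>
      then (SUP t\<in>{0<..}. ennreal (t powr enn2real (1 / p)) * max_rearr M h t)
      else enn_rpow
             (q / p * (\<integral>\<^sup>+ t\<in>{0<..}.
                enn_rpow (ennreal (t powr enn2real (1 / p)) * max_rearr M h t) (enn2real q)
                  * ennreal (1 / t) \<partial>lborel))
             (enn2real (1 / q)))"


section \<open>Lorentz spaces as spaces of a.e.-equivalence classes\<close>

definition ae_rel :: "'a measure \<Rightarrow> (('a \<Rightarrow> complex) \<times> ('a \<Rightarrow> complex)) set" where
  "ae_rel M = {(f, g). f \<in> borel_measurable M \<and> g \<in> borel_measurable M \<and> (AE x in M. f x = g x)}"

definition ae_class :: "'a measure \<Rightarrow> ('a \<Rightarrow> complex) \<Rightarrow> ('a \<Rightarrow> complex) set" where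
  "ae_class M f = ae_rel M `` {f}"

definition lorentz_space :: "'a measure \<Rightarrow> ennreal \<Rightarrow> ennreal \<Rightarrow> ('a \<Rightarrow> complex) set set" where
  "lorentz_space M p q = {f \<in> borel_measurable M. lorentz_norm M p q f < \<infinity>} // ae_rel M"

lemma equiv_ae_rel: "equiv (borel_measurable M) (ae_rel M)"
  unfolding equiv_def refl_on_def sym_def trans_def ae_rel_def by auto

lemma lorentz_norm_cong_AE:
  assumes "(f, g) \<in> ae_rel M"
  shows "lorentz_norm M p q f = lorentz_norm M p q g"
proof -
  have [measurable]: "f \<in> borel_measurable M" "g \<in> borel_measurable M" and "AE x in M. f x = g x"
    using assms by (auto simp: ae_rel_def)
  then have "distribution_fun M f = distribution_fun M g"
    unfolding distribution_fun_def by (intro ext emeasure_eq_AE) auto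
  then show ?thesis
    by (simp add: lorentz_norm_def max_rearr_def decr_rearr_def)
qed

text \<open>By the preceding lemma the norm is constant on each class, so the following is
  the common value.\<close>

definition class_norm :: "'a measure \<Rightarrow> ennreal \<Rightarrow> ennreal \<Rightarrow> ('a \<Rightarrow> complex) set \<Rightarrow> ennreal" where
  "class_norm M p q F = the_elem (lorentz_norm M p q ` F)"

text \<open>Boundedness as an operator on \<open>L(p,q)\<close>. Linearity is not part of this predicate: it is
  applied below only to weighted composition operators, which are linear by construction.\<close>

definition lorentz_bounded ::
    "'a measure \<Rightarrow> ennreal \<Rightarrow> ennreal \<Rightarrow> (('a \<Rightarrow> complex) set \<Rightarrow> ('a \<Rightarrow> complex) set) \<Rightarrow> bool" where
  "lorentz_bounded M p q L \<longleftrightarrow>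
     (\<forall>F\<in>lorentz_space M p q. L F \<in> lorentz_space M p q) \<and>
     (\<exists>C::real. \<forall>F\<in>lorentz_space M p q. class_norm M p q (L F) \<le> ennreal C * class_norm M p q F)"

definition null_space ::
    "'a measure \<Rightarrow> ennreal \<Rightarrow> ennreal \<Rightarrow> (('a \<Rightarrow> complex) set \<Rightarrow> ('a \<Rightarrow> complex) set)
       \<Rightarrow> ('a \<Rightarrow> complex) set set" where
  "null_space M p q L = {F \<in> lorentz_space M p q. L F = ae_class M (\<lambda>_. 0)}"

text \<open>In \<^typ>\<open>enat\<close> the infimum of the empty set is \<open>\<infinity>\<close>.\<close>

definition ascent ::
    "'a measure \<Rightarrow> ennreal \<Rightarrow> ennreal \<Rightarrow> (('a \<Rightarrow> complex) set \<Rightarrow> ('a \<Rightarrow> complex) set) \<Rightarrow> enat" where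
  "ascent M p q L =
     Inf (enat ` {k. null_space M p q (L ^^ (k + 1)) = null_space M p q (L ^^ k)})"


section \<open>Non-singular transformations and weighted composition operators\<close>

definition nonsingular :: "'a measure \<Rightarrow> ('a \<Rightarrow> 'a) \<Rightarrow> bool" where
  "nonsingular M T \<longleftrightarrow> T \<in> measurable M M \<and> (\<forall>A\<in>null_sets M. T -` A \<inter> space M \<in> null_sets M)"

definition iter_deriv :: "'a measure \<Rightarrow> ('a \<Rightarrow> 'a) \<Rightarrow> nat \<Rightarrow> 'a \<Rightarrow> ennreal" where
  "iter_deriv M T k = RN_deriv M (distr M M (T ^^ k))"

definition deriv_zero_set :: "'a measure \<Rightarrow> ('a \<Rightarrow> 'a) \<Rightarrow> nat \<Rightarrow> 'a set" where
  "deriv_zero_set M T k = {x \<in> space M. iter_deriv M T k x = 0}"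

definition deriv_supp_contained :: "'a measure \<Rightarrow> ('a \<Rightarrow> 'a) \<Rightarrow> nat \<Rightarrow> bool" where
  "deriv_supp_contained M T k \<longleftrightarrow>
     (space M - deriv_zero_set M T k) - (T ^^ (k + 1)) ` (space M - deriv_zero_set M T k)
       \<in> null_sets M"

text \<open>The map induced on classes by \<open>f \<mapsto> (u \<circ> T) \<cdot> (f \<circ> T)\<close>; for non-singular \<open>T\<close> all the sets
  in the union over representatives \<open>f\<close> coincide.\<close>

definition weighted_comp ::
    "'a measure \<Rightarrow> ('a \<Rightarrow> complex) \<Rightarrow> ('a \<Rightarrow> 'a) \<Rightarrow> ('a \<Rightarrow> complex) set \<Rightarrow> ('a \<Rightarrow> complex) set" where
  "weighted_comp M u T F = (\<Union>f\<in>F. ae_class M (\<lambda>x. u (T x) * f (T x)))"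

end

theory Submission
  imports Defs
begin

text \<open>Since \<open>T\<close> preserves null sets under images as well as preimages, the support of \<open>h\<close> for
  \<open>T\<^sup>k\<close> is \<open>T\<^sup>k(X)\<close> up to a null set. Hence the containment condition reads
  \<open>T\<^sup>k(X) = T\<^sup>2\<^sup>k\<^sup>+\<^sup>1(X)\<close> a.e., and as the ranges decrease this is equivalent to
  \<open>T\<^sup>k(X) = T\<^sup>k\<^sup>+\<^sup>1(X)\<close> a.e. On the other side, \<open>u \<circ> T\<^sup>j\<close> is a.e. nonzero for \<open>j \<ge> 1\<close>, so the
  null space of the \<open>k\<close>-th power of the operator consists of the functions vanishing a.e. on
  \<open>T\<^sup>k(X)\<close>. Because \<open>L(p,q)\<close> contains the indicators of all sets of finite measure, consecutive
  null spaces agree exactly when consecutive ranges do.\<close>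

section \<open>Indicators in Lorentz spaces\<close>

text \<open>The distribution function of an indicator is \<mu>(A) = a below level 1 and 0 from level
  1 on. So every s \<ge> 1 is admissible in the infimum, and every s > 0 as soon as a \<le> t. An
  upper bound is enough for finiteness of the norm.\<close>

lemma decr_rearr_indicator:
  assumes "A \<in> sets M" "emeasure M A = ennreal a" "0 \<le> a" "0 < t"
  shows "decr_rearr M (indicator A) t \<le> indicator {..<a} t"
proof -
  have "ennreal s \<in> ennreal ` {s. s > 0 \<and> distribution_fun M (indicator A) s \<le> ennreal t}"
    if "s > 0" "s \<ge> 1 \<or> a \<le> t" for s
  proof -
    have "distribution_fun M (indicator A) s = emeasure M (if s < 1 then A else {})"
      unfolding distribution_fun_def using \<open>s > 0\<close> sets.sets_into_space[OF assms(1)]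
      by (intro arg_cong[where f = "emeasure M"]) (auto simp: indicator_def split: if_splits)
    also have "\<dots> \<le> ennreal t"
      using that assms by (auto intro: ennreal_leI)
    finally show ?thesis using \<open>s > 0\<close> by auto
  qed
  then have le: "decr_rearr M (indicator A) t \<le> ennreal s" if "s > 0" "s \<ge> 1 \<or> a \<le> t" for s
    unfolding decr_rearr_def using that by (blast intro: Inf_lower)
  show ?thesis
  proof (cases "t < a")
    case True
    then show ?thesis using le[of 1] by simp
  next
    case False
    \<comment> \<open>The infimum runs over positive levels only, so the bound 0 is reached by
      letting s tend to 0.\<close>
    then have "decr_rearr M (indicator A) t \<le> 0 + ennreal s" if "s > 0" for s
      using le[of s] that by simp
    then have "decr_rearr M (indicator A) t \<le> 0"
      by (rule ennreal_le_epsilon)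
    then show ?thesis by simp
  qed
qed

lemma max_rearr_indicator:
  assumes "A \<in> sets M" "emeasure M A = ennreal a" "0 \<le> a" "0 < t"
  shows "max_rearr M (indicator A) t \<le> ennreal (min 1 (a / t))"
proof -
  have "(\<integral>\<^sup>+ s\<in>{0<..<t}. decr_rearr M (indicator A) s \<partial>lborel)
      \<le> (\<integral>\<^sup>+ s. indicator {0<..<min a t} s \<partial>lborel)"
  proof (rule nn_integral_mono)
    fix s
    show "decr_rearr M (indicator A) s * indicator {0<..<t} s \<le> indicator {0<..<min a t} s"
      using decr_rearr_indicator[OF assms(1-3), of s] by (auto simp: indicator_def split: if_splits)
  qed
  also have "\<dots> = ennreal (min a t)"
    using assms by simp
  finally have "max_rearr M (indicator A) t \<le> ennreal (1 / t) * ennreal (min a t)"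
    unfolding max_rearr_def by (rule mult_left_mono) simp
  also have "\<dots> = ennreal (min 1 (a / t))"
    using assms by (subst ennreal_mult[symmetric]) (auto simp: min_def field_simps)
  finally show ?thesis .
qed

lemma enn_rpow_mono:
  assumes "x \<le> y" "0 \<le> a"
  shows "enn_rpow x a \<le> enn_rpow y a"
  using assms by (auto simp: enn_rpow_def top_unique less_top intro!: ennreal_leI powr_mono2 enn2real_mono)

lemma enn_rpow_less_top: "x < top \<Longrightarrow> enn_rpow x a < top"
  by (simp add: enn_rpow_def)

text \<open>With r = 1/p, the bound r < 1 gives decay at infinity and r > 0 gives integrability at
  0. For p = \<infinity> the value is r = 0, which occurs only together with q =
  \<infinity>.\<close>

lemma lorentz_exponent_bounds:
  assumes "1 < (p::ennreal)"
  shows "0 \<le> enn2real (1 / p)" "enn2real (1 / p) < 1" "p < \<infinity> \<Longrightarrow> 0 < enn2real (1 / p)"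
proof -
  show "0 \<le> enn2real (1 / p)" by simp
  have *: "enn2real (1 / p) = 1 / r" "r > 1" if "p = ennreal r" "r \<ge> 0" for r
  proof -
    show "r > 1" using that assms by simp
    then show "enn2real (1 / p) = 1 / r"
      using that by (simp add: divide_ennreal flip: ennreal_1)
  qed
  show "enn2real (1 / p) < 1"
    by (cases p) (use * in auto)
  show "0 < enn2real (1 / p)" if "p < \<infinity>"
    by (cases p) (use that * in auto)
qed

lemma lorentz_norm_indicator_finite:
  assumes exps: "lorentz_exponents p q" and A: "A \<in> sets M" "emeasure M A < \<infinity>"
  shows "lorentz_norm M p q (indicator A) < \<infinity>"
proof -
  obtain a where a: "emeasure M A = ennreal a" "0 \<le> a"
    using A(2) by (cases "emeasure M A") auto
  define r where "r = enn2real (1 / p)"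
  have p: "1 < p" using exps by (auto simp: lorentz_exponents_def)
  have r: "0 \<le> r" "r < 1" "p < \<infinity> \<Longrightarrow> 0 < r"
    using lorentz_exponent_bounds[OF p] by (auto simp: r_def)
  \<comment> \<open>This is the minimum of t^r and a * t^(r-1); the first branch is used near 0, the
    second near infinity.\<close>
  define b where "b t = t powr r * min 1 (a / t)" for t
  have b_nonneg: "0 \<le> b t" if "t > 0" for t using that a by (auto simp: b_def)
  have le_b: "ennreal (t powr r) * max_rearr M (indicator A) t \<le> ennreal (b t)" if "t > 0" for t
  proof -
    have "ennreal (t powr r) * max_rearr M (indicator A) t
        \<le> ennreal (t powr r) * ennreal (min 1 (a / t))"
      using max_rearr_indicator[OF A(1) a that] by (rule mult_left_mono) simp
    then show ?thesis using that a by (simp add: b_def ennreal_mult'')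
  qed
  have b_small: "b t \<le> t powr r" if "t > 0" for t
    using that by (auto simp: b_def intro!: mult_left_le)
  have b_large: "b t \<le> a * t powr (r - 1)" if "t > 0" for t
  proof -
    have "b t \<le> t powr r * (a / t)"
      unfolding b_def by (intro mult_left_mono) auto
    also have "\<dots> = a * t powr (r - 1)"
      using that by (simp add: powr_diff)
    finally show ?thesis .
  qed
  show ?thesis
  proof (cases "q = \<infinity>")
    case True
    have "b t \<le> max 1 a" if "t > 0" for t
    proof (cases "t \<le> 1")
      case True
      then have "t powr r \<le> 1" using that r(1) by (simp add: powr_le1)
      then show ?thesis using b_small[OF that] by simp
    next
      case False
      then have "a * t powr (r - 1) \<le> a * 1"
        using r a(2) powr_mono[of "r - 1" 0 t] by (intro mult_left_mono) auto
      then show ?thesis using b_large[OF that] by simp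
    qed
    then have "(SUP t\<in>{0<..}. ennreal (t powr r) * max_rearr M (indicator A) t) \<le> ennreal (max 1 a)"
      using le_b by (intro SUP_least) (meson ennreal_leI greaterThan_iff order_trans)
    also have "\<dots> < \<infinity>" by simp
    finally show ?thesis using True by (simp add: lorentz_norm_def r_def)
  next
    case False
    then have pq: "p < \<infinity>" "1 \<le> q" "q < \<infinity>" using exps by (auto simp: lorentz_exponents_def)
    define c where "c = enn2real q"
    have c: "1 \<le> c" using pq by (cases q) (auto simp: c_def)
    have r0: "0 < r" using r(3) pq by simp
    \<comment> \<open>Integrable majorants on (0,1] and [1,\<infinity>), obtained from the two
      branches of \<open>b\<close>: the first exponent exceeds -1 since r * c > 0, the second is
      below -1 since (r - 1) * c < 0.\<close>
    let ?f = "\<lambda>t::real. t powr (r * c - 1)"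
    let ?g = "\<lambda>t::real. a powr c * t powr ((r - 1) * c - 1)"
    have fi: "(?f has_integral 1 powr (r * c - 1 + 1) / (r * c - 1 + 1)) {0..1}"
      using r0 c by (intro has_integral_powr_from_0) auto
    have gi: "(?g has_integral
        a powr c * (- (1 powr ((r - 1) * c - 1 + 1)) / ((r - 1) * c - 1 + 1))) {1..}"
      using r c by (intro has_integral_mult_right has_integral_powr_to_inf) (auto simp: mult_neg_pos)
    have qp: "q / p < \<infinity>"
      using pq p by (auto simp: ennreal_divide_eq_top_iff simp flip: less_top)
    have "(\<integral>\<^sup>+ t\<in>{0<..}. enn_rpow (ennreal (t powr r) * max_rearr M (indicator A) t) c
          * ennreal (1 / t) \<partial>lborel)
        \<le> (\<integral>\<^sup>+ t. ennreal (indicator {0..1} t * ?f t) + ennreal (indicator {1..} t * ?g t) \<partial>lborel)"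
    proof (rule nn_integral_mono)
      fix t :: real
      let ?l = "enn_rpow (ennreal (t powr r) * max_rearr M (indicator A) t) c * ennreal (1 / t)"
      have *: "?l \<le> ennreal (s powr c / t)" if "t > 0" "b t \<le> s" for s
      proof -
        have "?l \<le> enn_rpow (ennreal s) c * ennreal (1 / t)"
          using le_b[OF that(1)] that c
          by (intro mult_right_mono enn_rpow_mono) (auto intro: order_trans ennreal_leI)
        also have "\<dots> = ennreal (s powr c / t)"
          using that b_nonneg[of t] by (simp add: enn_rpow_def flip: ennreal_mult)
        finally show ?thesis .
      qed
      have "?l \<le> ennreal (?f t)" if "t > 0"
        using *[OF that b_small[OF that]] that by (simp add: powr_powr powr_diff)
      moreover have "?l \<le> ennreal (?g t)" if "t > 0"
        using *[OF that b_large[OF that]] that a powr_diff[of t "(r - 1) * c" 1]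
        by (simp add: powr_powr powr_mult)
      ultimately show "?l * indicator {0<..} t
          \<le> ennreal (indicator {0..1} t * ?f t) + ennreal (indicator {1..} t * ?g t)"
        by (cases "t \<le> 1") (auto simp: indicator_def intro: add_increasing2)
    qed
    also have "\<dots> = (\<integral>\<^sup>+ t. ennreal (indicator {0..1} t * ?f t) \<partial>lborel)
        + (\<integral>\<^sup>+ t. ennreal (indicator {1..} t * ?g t) \<partial>lborel)"
      by (intro nn_integral_add) auto
    also have "\<dots> < \<infinity>"
      using nn_integral_has_integral_lebesgue[OF _ fi] nn_integral_has_integral_lebesgue[OF _ gi]
      by simp
    finally have "q / p * (\<integral>\<^sup>+ t\<in>{0<..}. enn_rpow (ennreal (t powr r) * max_rearr M (indicator A) t) c
          * ennreal (1 / t) \<partial>lborel) < \<infinity>"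
      using qp by (simp add: ennreal_mult_less_top)
    then show ?thesis
      using False by (simp add: lorentz_norm_def r_def c_def enn_rpow_less_top)
  qed
qed


section \<open>Weighted composition operators on equivalence classes\<close>

text \<open>The operator on representatives, where powers can be computed pointwise before passing
  to classes.\<close>

definition weighted_comp_fun :: "('a \<Rightarrow> complex) \<Rightarrow> ('a \<Rightarrow> 'a) \<Rightarrow> ('a \<Rightarrow> complex) \<Rightarrow> 'a \<Rightarrow> complex" where
  "weighted_comp_fun u T f = (\<lambda>x. u (T x) * f (T x))"

lemma ae_class_cong:
  assumes "(f, g) \<in> ae_rel M"
  shows "ae_class M f = ae_class M g"
  unfolding ae_class_def using equiv_ae_rel assms by (rule equiv_class_eq)

lemma ae_class_eq_zero_iff:
  assumes [measurable]: "f \<in> borel_measurable M"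
  shows "ae_class M f = ae_class M (\<lambda>_. 0) \<longleftrightarrow> (AE x in M. f x = 0)"
proof -
  have "ae_class M f = ae_class M (\<lambda>_. 0) \<longleftrightarrow> (f, \<lambda>_. 0) \<in> ae_rel M"
    unfolding ae_class_def using assms by (intro eq_equiv_class_iff[OF equiv_ae_rel]) simp_all
  then show ?thesis using assms by (simp add: ae_rel_def)
qed

lemma nonsingular_AE:
  assumes "nonsingular M T" "AE x in M. P x"
  shows "AE x in M. P (T x)"
proof -
  have [measurable]: "T \<in> measurable M M" using assms by (simp add: nonsingular_def)
  obtain N where N: "N \<in> null_sets M" "{x \<in> space M. \<not> P x} \<subseteq> N"
    using assms(2) by (auto elim!: AE_E)
  then have "T -` N \<inter> space M \<in> null_sets M"
    using assms(1) by (simp add: nonsingular_def)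
  moreover have "{x \<in> space M. \<not> P (T x)} \<subseteq> T -` N \<inter> space M"
    using N(2) measurable_space[OF \<open>T \<in> measurable M M\<close>] by auto
  ultimately show ?thesis by (rule AE_I')
qed

lemma nonsingular_funpow:
  assumes "nonsingular M T"
  shows "nonsingular M (T ^^ k)"
proof (induction k)
  case 0
  then show ?case
    by (simp add: nonsingular_def id_def Int_absorb2 sets.sets_into_space null_setsD2)
next
  case (Suc k)
  have meas: "T \<in> measurable M M" "T ^^ k \<in> measurable M M"
    using assms Suc by (simp_all add: nonsingular_def)
  have "(T ^^ Suc k) -` A \<inter> space M \<in> null_sets M" if "A \<in> null_sets M" for A
  proof -
    have "(T ^^ Suc k) -` A \<inter> space M = (T ^^ k) -` (T -` A \<inter> space M) \<inter> space M"
      using measurable_space[OF meas(2)] by auto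
    also have "\<dots> \<in> null_sets M"
      using that Suc assms unfolding nonsingular_def by blast
    finally show ?thesis .
  qed
  moreover have "T ^^ Suc k \<in> measurable M M"
    using measurable_comp[OF meas(2,1)] by simp
  ultimately show ?case
    by (simp only: nonsingular_def) blast
qed

text \<open>By non-singularity, a.e. equal representatives stay a.e. equal after composition with T,
  so the union defining \<open>weighted_comp\<close> collapses to a single class.\<close>

lemma weighted_comp_ae_class:
  assumes "nonsingular M T" and [measurable]: "u \<in> borel_measurable M" "f \<in> borel_measurable M"
  shows "weighted_comp M u T (ae_class M f) = ae_class M (weighted_comp_fun u T f)"
proof -
  have [measurable]: "T \<in> measurable M M" using assms by (simp add: nonsingular_def)
  have "ae_class M (\<lambda>x. u (T x) * g (T x)) = ae_class M (weighted_comp_fun u T f)"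
    if "g \<in> ae_class M f" for g
  proof (rule ae_class_cong)
    have [measurable]: "g \<in> borel_measurable M" and "AE x in M. f x = g x"
      using that by (auto simp: ae_class_def ae_rel_def)
    from nonsingular_AE[OF assms(1) this(2)]
    have "AE x in M. u (T x) * g (T x) = u (T x) * f (T x)"
      by eventually_elim simp
    then show "(\<lambda>x. u (T x) * g (T x), weighted_comp_fun u T f) \<in> ae_rel M"
      by (simp add: ae_rel_def weighted_comp_fun_def)
  qed
  moreover have "f \<in> ae_class M f"
    using assms(3) by (simp add: ae_class_def ae_rel_def)
  ultimately show ?thesis
    unfolding weighted_comp_def by (intro UN_constant_eq[where a = f]) blast+
qed

lemma weighted_comp_funpow_ae_class:
  assumes "nonsingular M T" "u \<in> borel_measurable M" "f \<in> borel_measurable M"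
  shows "(weighted_comp_fun u T ^^ k) f \<in> borel_measurable M"
    and "(weighted_comp M u T ^^ k) (ae_class M f) = ae_class M ((weighted_comp_fun u T ^^ k) f)"
proof -
  have [measurable]: "T \<in> measurable M M" using assms by (simp add: nonsingular_def)
  note [measurable] = assms(2)
  show *: "(weighted_comp_fun u T ^^ k) f \<in> borel_measurable M" for k
    by (induction k) (simp_all add: assms weighted_comp_fun_def)
  show "(weighted_comp M u T ^^ k) (ae_class M f) = ae_class M ((weighted_comp_fun u T ^^ k) f)"
    by (induction k) (simp_all add: weighted_comp_ae_class assms *)
qed

text \<open>The k-th iterate is f \<circ> T^k times the product of the u \<circ> T^j for 1 \<le> j
  \<le> k, and each factor is a.e. nonzero by non-singularity.\<close>

lemma weighted_comp_fun_funpow_eq_0: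
  assumes T: "nonsingular M T" and u: "AE x in M. u (T x) \<noteq> 0"
  shows "AE x in M. (weighted_comp_fun u T ^^ k) f x = 0 \<longleftrightarrow> f ((T ^^ k) x) = 0"
proof (induction k)
  case (Suc k)
  \<comment> \<open>The outermost application evaluates the k-th iterate at T x, so the induction
    hypothesis has to be pulled back along T.\<close>
  from nonsingular_AE[OF T this] u show ?case
    by eventually_elim (simp add: weighted_comp_fun_def funpow_swap1)
qed simp


section \<open>Ranges of iterates\<close>

text \<open>The inequality \<mu>(T(A)) \<le> \<mu>(A) enters through its consequence that T maps
  null sets to null sets.\<close>

locale null_preserving = sigma_finite_measure M + complete_measure M
  for M :: "'a measure" +
  fixes T :: "'a \<Rightarrow> 'a"
  assumes nonsing: "nonsingular M T"
    and image_sets: "A \<in> sets M \<Longrightarrow> T ` A \<in> sets M"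
    and image_null_sets: "A \<in> null_sets M \<Longrightarrow> T ` A \<in> null_sets M"
begin

definition iter_range :: "nat \<Rightarrow> 'a set" where
  "iter_range k = (T ^^ k) ` space M"

lemma null_mono: "B \<in> null_sets M \<Longrightarrow> A \<subseteq> B \<Longrightarrow> A \<in> null_sets M"
  by (rule complete2)

lemma funpow_measurable: "T ^^ k \<in> measurable M M"
  using nonsingular_funpow[OF nonsing] by (simp add: nonsingular_def)

lemma funpow_Suc_image: "(T ^^ Suc k) ` A = T ` ((T ^^ k) ` A)"
  by auto

lemma funpow_image_sets: "A \<in> sets M \<Longrightarrow> (T ^^ k) ` A \<in> sets M"
  by (induction k) (simp_all add: image_sets funpow_Suc_image del: funpow.simps(2))

lemma funpow_image_null_sets: "A \<in> null_sets M \<Longrightarrow> (T ^^ k) ` A \<in> null_sets M"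
  by (induction k) (simp_all add: image_null_sets funpow_Suc_image del: funpow.simps(2))

lemma iter_range_sets: "iter_range k \<in> sets M"
  by (simp add: iter_range_def funpow_image_sets)

lemma funpow_iter_range: "(T ^^ n) ` iter_range k = iter_range (n + k)"
  by (simp add: iter_range_def image_comp funpow_add)

lemma iter_range_antimono:
  assumes "j \<le> k"
  shows "iter_range k \<subseteq> iter_range j"
proof -
  obtain n where n: "k = j + n" using assms le_Suc_ex by blast
  have "(T ^^ n) ` space M \<subseteq> space M"
    using measurable_space[OF funpow_measurable] by blast
  then show ?thesis
    by (auto simp: n iter_range_def funpow_add)
qed

text \<open>The loss from step k+n to step k+n+1 lies in the image under T^n of the loss from k to
  k+1, hence is null; the losses then add up.\<close>

lemma iter_range_diff_null:
  assumes "iter_range k - iter_range (Suc k) \<in> null_sets M"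
  shows "iter_range k - iter_range (k + n) \<in> null_sets M"
proof (induction n)
  case (Suc n)
  have "iter_range (k + n) - iter_range (Suc (k + n))
      \<subseteq> (T ^^ n) ` (iter_range k - iter_range (Suc k))"
    using image_diff_subset[of "T ^^ n" "iter_range k" "iter_range (Suc k)"]
    by (simp add: funpow_iter_range add.commute)
  from null_mono[OF funpow_image_null_sets[OF assms] this]
  have "(iter_range k - iter_range (k + n)) \<union> (iter_range (k + n) - iter_range (Suc (k + n)))
      \<in> null_sets M"
    using Suc by (intro null_sets.Un)
  then show ?case by (rule null_mono) auto
qed simp

section \<open>Supports of the derivatives and ranges of the iterates\<close>

text \<open>Both sides say \<mu>_k(A) = 0, because \<mu>_k(A) is the integral over A of a
  nonnegative function that vanishes exactly on \<open>deriv_zero_set M T k\<close>.\<close>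

lemma deriv_zero_set_null_iff:
  assumes "A \<in> sets M"
  shows "A - deriv_zero_set M T k \<in> null_sets M \<longleftrightarrow> (T ^^ k) -` A \<inter> space M \<in> null_sets M"
proof -
  let ?N = "distr M M (T ^^ k)"
  note [measurable] = funpow_measurable assms
  have [measurable]: "iter_deriv M T k \<in> borel_measurable M"
    by (simp add: iter_deriv_def)
  have "absolutely_continuous M ?N"
    using nonsingular_funpow[OF nonsing, of k]
    by (auto simp: absolutely_continuous_def nonsingular_def null_sets_distr_iff)
  then have d: "density M (iter_deriv M T k) = ?N"
    unfolding iter_deriv_def by (rule density_RN_deriv) simp
  have "(T ^^ k) -` A \<inter> space M \<in> null_sets M \<longleftrightarrow> A \<in> null_sets ?N"
    by (simp add: null_sets_distr_iff)
  also have "\<dots> \<longleftrightarrow> (AE x in M. x \<in> A \<longrightarrow> iter_deriv M T k x = 0)"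
    unfolding d[symmetric] by (subst null_sets_density_iff) auto
  also have "\<dots> \<longleftrightarrow> (AE x in M. x \<notin> A - deriv_zero_set M T k)"
    by (rule AE_cong) (auto simp: deriv_zero_set_def)
  also have "\<dots> \<longleftrightarrow> A - deriv_zero_set M T k \<in> null_sets M"
    by (rule Measure_Space.AE_iff_null_sets[symmetric]) (simp add: deriv_zero_set_def)
  finally show ?thesis by blast
qed

text \<open>The zero set of u lies in X_1 up to a null set, so its preimage under T is null.\<close>

lemma AE_weight_comp_nonzero:
  fixes u :: "'a \<Rightarrow> complex"
  assumes [measurable]: "u \<in> borel_measurable M"
    and "AE x in M. u x = 0 \<longrightarrow> iter_deriv M T 1 x = 0"
  shows "AE x in M. u (T x) \<noteq> 0"
proof -
  let ?A = "{x \<in> space M. u x = 0}"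
  have [measurable]: "?A \<in> sets M" "iter_deriv M T 1 \<in> borel_measurable M"
    by (measurable, simp add: iter_deriv_def)
  have "AE x in M. x \<notin> ?A - deriv_zero_set M T 1"
    using assms(2) by eventually_elim (simp add: deriv_zero_set_def)
  then have "?A - deriv_zero_set M T 1 \<in> null_sets M"
    by (subst Measure_Space.AE_iff_null_sets) (simp_all add: deriv_zero_set_def del: One_nat_def)
  then have "T -` ?A \<inter> space M \<in> null_sets M"
    by (simp add: deriv_zero_set_null_iff)
  then show ?thesis
    by (rule AE_I') (use measurable_space[OF funpow_measurable[of 1]] in auto)
qed

text \<open>As \<open>T\<close> maps null sets to null sets, \<open>h\<^sub>k\<close> cannot vanish on a non-null part of \<open>T\<^sup>k(X)\<close>: the
  supports of the derivatives are exactly the ranges of the iterates, up to null sets.\<close>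

lemma deriv_support_iter_range:
  shows "(space M - deriv_zero_set M T k) - iter_range k \<in> null_sets M"
    and "iter_range k - (space M - deriv_zero_set M T k) \<in> null_sets M"
proof -
  have "(T ^^ k) -` (space M - iter_range k) \<inter> space M = {}"
    by (auto simp: iter_range_def)
  then have "(space M - iter_range k) - deriv_zero_set M T k \<in> null_sets M"
    using iter_range_sets by (subst deriv_zero_set_null_iff) auto
  then show "(space M - deriv_zero_set M T k) - iter_range k \<in> null_sets M"
    by (rule null_mono) auto
next
  have "iter_deriv M T k \<in> borel_measurable M"
    by (simp add: iter_deriv_def)
  then have "deriv_zero_set M T k \<in> sets M"
    unfolding deriv_zero_set_def by measurable
  then have "(T ^^ k) -` deriv_zero_set M T k \<inter> space M \<in> null_sets M"
    using deriv_zero_set_null_iff by fastforce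
  \<comment> \<open>A point of the range outside the support is the image under T^k of a point of
    this null preimage.\<close>
  from funpow_image_null_sets[OF this, of k]
  show "iter_range k - (space M - deriv_zero_set M T k) \<in> null_sets M"
    by (rule null_mono) (use sets.sets_into_space[OF iter_range_sets] in \<open>auto simp: iter_range_def\<close>)
qed

lemma deriv_supp_contained_iff:
  "deriv_supp_contained M T k \<longleftrightarrow> iter_range k - iter_range (Suc k) \<in> null_sets M"
proof -
  let ?S = "space M - deriv_zero_set M T k"
  let ?T = "image (T ^^ (k + 1))"
  note null = deriv_support_iter_range[of k]
  \<comment> \<open>Applying T^(k+1) to T^k(X) gives the index 2k+1 \<ge> k+1, which is where
    monotonicity and stabilisation of the ranges come in.\<close>
  have image: "?T (iter_range k) = iter_range (k + Suc k)"
    using funpow_iter_range[of "k + 1" k] by (simp add: add.commute)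
  show ?thesis
  proof
    assume "deriv_supp_contained M T k"
    \<comment> \<open>The errors are collected in one null set: from the range to the support, from
      the support to its image, and the image of what the support has outside the range.\<close>
    then have "(iter_range k - ?S) \<union> (?S - ?T ?S) \<union> ?T (?S - iter_range k) \<in> null_sets M"
      unfolding deriv_supp_contained_def by (intro null_sets.Un null funpow_image_null_sets)
    moreover have "iter_range (k + Suc k) \<subseteq> iter_range (Suc k)"
      by (rule iter_range_antimono) simp
    then have "?T ?S \<subseteq> iter_range (Suc k) \<union> ?T (?S - iter_range k)"
      using image by blast
    ultimately show "iter_range k - iter_range (Suc k) \<in> null_sets M"
      by (elim null_mono) blast
  next
    assume "iter_range k - iter_range (Suc k) \<in> null_sets M"
    then have "(?S - iter_range k) \<union> (iter_range k - iter_range (k + Suc k))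
        \<union> ?T (iter_range k - ?S) \<in> null_sets M"
      by (intro null_sets.Un null iter_range_diff_null funpow_image_null_sets)
    moreover have "iter_range (k + Suc k) \<subseteq> ?T ?S \<union> ?T (iter_range k - ?S)"
      unfolding image[symmetric] by blast
    ultimately show "deriv_supp_contained M T k"
      unfolding deriv_supp_contained_def by (elim null_mono) blast
  qed
qed

section \<open>Null spaces of the powers\<close>

text \<open>The two exceptional sets are preimage and image of each other under T^k, and null sets
  are preserved in both directions.\<close>

lemma AE_comp_funpow_eq_0_iff:
  fixes f :: "'a \<Rightarrow> complex"
  assumes [measurable]: "f \<in> borel_measurable M"
  shows "(AE x in M. f ((T ^^ k) x) = 0) \<longleftrightarrow> {x \<in> iter_range k. f x \<noteq> 0} \<in> null_sets M"
proof -
  note [measurable] = funpow_measurable iter_range_sets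
  let ?A = "{x \<in> iter_range k. f x \<noteq> 0}" and ?B = "{x \<in> space M. f ((T ^^ k) x) \<noteq> 0}"
  have "?B = (T ^^ k) -` ?A \<inter> space M" "?A = (T ^^ k) ` ?B"
    by (auto simp: iter_range_def)
  then have "?B \<in> null_sets M \<longleftrightarrow> ?A \<in> null_sets M"
    using nonsingular_funpow[OF nonsing, of k] funpow_image_null_sets[of ?B k]
    by (metis (no_types, lifting) nonsingular_def)
  moreover have "?B \<in> sets M" by measurable
  ultimately show ?thesis
    by (simp add: AE_iff_null)
qed

lemma null_space_weighted_comp_iff:
  assumes "u \<in> borel_measurable M" "AE x in M. u (T x) \<noteq> 0"
    and f: "f \<in> borel_measurable M" "lorentz_norm M p q f < \<infinity>"
  shows "ae_class M f \<in> null_space M p q (weighted_comp M u T ^^ k)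
    \<longleftrightarrow> {x \<in> iter_range k. f x \<noteq> 0} \<in> null_sets M"
proof -
  have "ae_class M f \<in> lorentz_space M p q"
    unfolding lorentz_space_def ae_class_def using f by (intro quotientI) simp
  then have "ae_class M f \<in> null_space M p q (weighted_comp M u T ^^ k)
      \<longleftrightarrow> (AE x in M. (weighted_comp_fun u T ^^ k) f x = 0)"
    using weighted_comp_funpow_ae_class[OF nonsing assms(1) f(1), of k]
    by (simp add: null_space_def ae_class_eq_zero_iff)
  also have "\<dots> \<longleftrightarrow> (AE x in M. f ((T ^^ k) x) = 0)"
    using weighted_comp_fun_funpow_eq_0[OF nonsing assms(2)] by (rule eventually_subst)
  finally show ?thesis
    using AE_comp_funpow_eq_0_iff[OF f(1)] by simp
qed

lemma null_space_weighted_comp_Suc_eq_iff: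
  assumes "lorentz_exponents p q" and u: "u \<in> borel_measurable M" "AE x in M. u (T x) \<noteq> 0"
  shows "null_space M p q (weighted_comp M u T ^^ Suc k) = null_space M p q (weighted_comp M u T ^^ k)
    \<longleftrightarrow> iter_range k - iter_range (Suc k) \<in> null_sets M"
    (is "?N (Suc k) = ?N k \<longleftrightarrow> ?D \<in> _")
proof
  note iff = null_space_weighted_comp_iff[OF u]
  assume eq: "?N (Suc k) = ?N k"
  show "?D \<in> null_sets M"
  proof (rule ccontr)
    assume "?D \<notin> null_sets M"
    moreover have D: "?D \<in> sets M" by (intro sets.Diff iter_range_sets)
    ultimately have pos: "emeasure M ?D \<noteq> 0" by (simp add: null_sets_def)
    \<comment> \<open>If the difference has infinite measure, \<sigma>-finiteness supplies a subset
      of finite measure above any given bound; 1 serves as a positive one.\<close>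
    obtain B where B: "B \<in> sets M" "B \<subseteq> ?D" "emeasure M B < \<infinity>" "emeasure M B \<noteq> 0"
    proof (cases "emeasure M ?D = \<infinity>")
      case True
      obtain Z where "Z \<in> sets M" "Z \<subseteq> ?D" "emeasure M Z < \<infinity>" "emeasure M Z > ennreal 1"
        by (rule approx_PInf_emeasure_with_finite[OF D True, where C = 1])
      then show ?thesis by (intro that) auto
    next
      case False
      then show ?thesis by (intro that[of ?D] D pos) (auto simp flip: less_top)
    qed
    \<comment> \<open>This function vanishes on T^(k+1)(X) but not a.e. on T^k(X), so its class
      separates the two null spaces.\<close>
    let ?f = "indicator B :: 'a \<Rightarrow> complex"
    have f: "?f \<in> borel_measurable M" "lorentz_norm M p q ?f < \<infinity>"
      using B(1,3) assms(1) by (blast intro: borel_measurable_indicator lorentz_norm_indicator_finite)+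
    have "{x \<in> iter_range (Suc k). ?f x \<noteq> 0} = {}" "{x \<in> iter_range k. ?f x \<noteq> 0} = B"
      using B(2) by (auto simp: indicator_def)
    then have "ae_class M ?f \<in> ?N (Suc k)" "ae_class M ?f \<notin> ?N k"
      unfolding iff[OF f] using B(4) by (simp_all only:) auto
    then show False using eq by simp
  qed
next
  assume D: "?D \<in> null_sets M"
  show "?N (Suc k) = ?N k"
  proof (rule set_eqI)
    fix F
    show "F \<in> ?N (Suc k) \<longleftrightarrow> F \<in> ?N k"
    proof (cases "F \<in> lorentz_space M p q")
      case True
      then obtain f where f: "f \<in> borel_measurable M" "lorentz_norm M p q f < \<infinity>"
        and F: "F = ae_class M f"
        unfolding lorentz_space_def ae_class_def by (auto elim: quotientE)
      let ?A = "\<lambda>j. {x \<in> iter_range j. f x \<noteq> 0}"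
      \<comment> \<open>The two nonvanishing sets differ only inside the null set
        \<open>?D\<close>.\<close>
      have "?A (Suc k) \<subseteq> ?A k" "?A k \<subseteq> ?D \<union> ?A (Suc k)"
        using iter_range_antimono[of k "Suc k"] by auto
      then have "?A (Suc k) \<in> null_sets M \<longleftrightarrow> ?A k \<in> null_sets M"
        using null_mono[of "?A k" "?A (Suc k)"] null_mono[of "?D \<union> ?A (Suc k)" "?A k"]
          null_sets.Un[OF D, of "?A (Suc k)"] by argo
      then show ?thesis
        unfolding F null_space_weighted_comp_iff[OF u f] .
    qed (simp add: null_space_def)
  qed
qed

end

theorem theorem4p11:
  fixes M :: "'a measure" and T :: "'a \<Rightarrow> 'a" and u :: "'a \<Rightarrow> complex"
    and p q :: ennreal and k :: nat
  assumes "sigma_finite_measure M"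
    and "complete_measure M"
    and "lorentz_exponents p q"
    and "nonsingular M T"
    and "u \<in> borel_measurable M"
    and "\<not> (AE x in M. u x = 0)"
    and "lorentz_bounded M p q (weighted_comp M u T)"
    and "\<And>A. A \<in> sets M \<Longrightarrow> T ` A \<in> sets M \<and> emeasure M (T ` A) \<le> emeasure M A"
    and "AE x in M. u x = 0 \<longrightarrow> iter_deriv M T 1 x = 0"
    and "\<exists>C::real. AE x in M. norm (u x) \<le> C"
    and "deriv_supp_contained M T k"
    and "\<And>j. j < k \<Longrightarrow> \<not> deriv_supp_contained M T j"
  shows "ascent M p q (weighted_comp M u T) = enat k"
proof -
  have "T ` A \<in> null_sets M" if "A \<in> null_sets M" for A
    using that assms(8)[of A] by (auto simp: null_sets_def)
  then interpret null_preserving M T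
    using assms unfolding null_preserving_def null_preserving_axioms_def by blast
  have "{j. null_space M p q (weighted_comp M u T ^^ (j + 1)) = null_space M p q (weighted_comp M u T ^^ j)}
      = {j. deriv_supp_contained M T j}"
    unfolding Suc_eq_plus1[symmetric] deriv_supp_contained_iff
    by (simp only: null_space_weighted_comp_Suc_eq_iff[OF assms(3,5)
          AE_weight_comp_nonzero[OF assms(5,9)]])
  \<comment> \<open>By the minimality of k, the infimum in \<open>enat\<close> is attained at
    k.\<close>
  moreover have "Inf (enat ` {j. deriv_supp_contained M T j}) = enat k"
    using assms(11,12) by (intro cInf_eq_minimum) (auto simp: not_less[symmetric])
  ultimately show ?thesis
    by (simp add: ascent_def)
qed

end
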